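(* Let $n\ge 1$ be an integer, let $Y$ be any topological space with at least $n$ points, and let $X=C^n(Y\times I)$. Then $$\mathrm{TC}_X(C^n(Y)\times C^n(Y))\le \mathrm{TC}(Y^n).$$
   Context: $I=[0,1]$. For a space $X$, $P(X)$ is the space of all continuous maps $\sigma\colon I\to X$ with the compact-open topology. $\mathrm{TC}(X)$ is the smallest integer $k$ such that $X\times X$ has an open cover $U_1,\dots,U_k$ for which there are continuous maps $s_i\colon U_i\to P(X)$ with $s_i(x,y)(0)=x$ and $s_i(x,y)(1)=y$ for all $(x,y)\in U_i$; if no such $k$ exists, $\mathrm{TC}(X)=\infty$. For $A\subseteq X\times X$, $P_X(A)\subseteq P(X)$ is the subspace of paths $\sigma$ with $(\sigma(0),\sigma(1))\in A$, and $\mathrm{TC}_X(A)$ is the smallest integer $k$ such that $A$ has a cover by sets $U_1,\dots,U_k$ open in $A$ for which there are continuous maps $s_i\colon U_i\to P_X(A)$ with $s_i(x,y)(0)=x$ and $s_i(x,y)(1)=y$ for all $(x,y)\in U_i$; if no such $k$ exists, $\mathrm{TC}_X(A)=\infty$. (Paths may leave the subspaces in which their endpoints lie.) For any space $Z$, $C^n(Z)=\{(z_1,\dots,z_n)\in Z^n : z_i\neq z_j\text{ for }i\ne j\}$ with the subspace topology from $Z^n$. $Y$ is identified with the subspace $Y\times\{0\}$ of $Y\times I$, and correspondingly $C^n(Y)$ is viewed as a subspace of $C^n(Y\times I)$ via $(y_1,\dots,y_n)\mapsto((y_1,0),\dots,(y_n,0))$. *)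

theory Defs
  imports "HOL-Analysis.Analysis" "HOL-Library.Extended_Nat"
begin

text \<open>Continuous maps are represented by their extensional representatives, so that two maps
  agreeing on \<^term>\<open>topspace X\<close> are the same point.\<close>

definition continuous_maps :: "'a topology \<Rightarrow> 'b topology \<Rightarrow> ('a \<Rightarrow> 'b) set" where
  "continuous_maps X Y = {f \<in> extensional (topspace X). continuous_map X Y f}"

definition compact_open_topology :: "'a topology \<Rightarrow> 'b topology \<Rightarrow> ('a \<Rightarrow> 'b) topology" where
  "compact_open_topology X Y = topology_generated_by
     {{f \<in> continuous_maps X Y. f ` K \<subseteq> U} | K U. compactin X K \<and> openin Y U}"

lemma topspace_compact_open_topology:
  "topspace (compact_open_topology X Y) = continuous_maps X Y"
proof -
  have "continuous_maps X Y = {f \<in> continuous_maps X Y. f ` {} \<subseteq> {}}"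
    by simp
  then have "continuous_maps X Y
      \<in> {{f \<in> continuous_maps X Y. f ` K \<subseteq> U} | K U. compactin X K \<and> openin Y U}"
    using compactin_empty[of X] openin_empty[of Y] by blast
  then show ?thesis
    unfolding compact_open_topology_def topology_generated_by_topspace by blast
qed

abbreviation unit_interval :: "real topology" where
  "unit_interval \<equiv> top_of_set {0..1}"

definition path_space :: "'a topology \<Rightarrow> (real \<Rightarrow> 'a) topology" where
  "path_space X = compact_open_topology unit_interval X"

definition path_space_on :: "'a topology \<Rightarrow> ('a \<times> 'a) set \<Rightarrow> (real \<Rightarrow> 'a) topology" where
  "path_space_on X A = subtopology (path_space X) {p. (p 0, p 1) \<in> A}"

text \<open>The infimum of the empty set is \<^term>\<open>\<infinity> :: enat\<close>.\<close>

definition TC :: "'a topology \<Rightarrow> enat" where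
  "TC X = Inf {enat k | k. \<exists>U s.
     (\<Union>i<k. U i) = topspace (prod_topology X X) \<and>
     (\<forall>i<k. openin (prod_topology X X) (U i) \<and>
       continuous_map (subtopology (prod_topology X X) (U i)) (path_space X) (s i) \<and>
       (\<forall>(x, y) \<in> U i. s i (x, y) 0 = x \<and> s i (x, y) 1 = y))}"

text \<open>The relative invariant is meant for \<^term>\<open>A \<subseteq> topspace X \<times> topspace X\<close>.\<close>

definition TC_on :: "'a topology \<Rightarrow> ('a \<times> 'a) set \<Rightarrow> enat" where
  "TC_on X A = Inf {enat k | k. \<exists>U s.
     (\<Union>i<k. U i) = A \<and>
     (\<forall>i<k. openin (subtopology (prod_topology X X) A) (U i) \<and>
       continuous_map (subtopology (prod_topology X X) (U i)) (path_space_on X A) (s i) \<and>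
       (\<forall>(x, y) \<in> U i. s i (x, y) 0 = x \<and> s i (x, y) 1 = y))}"

abbreviation power_topology :: "nat \<Rightarrow> 'a topology \<Rightarrow> (nat \<Rightarrow> 'a) topology" where
  "power_topology n Z \<equiv> product_topology (\<lambda>_. Z) {..<n}"

definition config_space :: "nat \<Rightarrow> 'a topology \<Rightarrow> (nat \<Rightarrow> 'a) topology" where
  "config_space n Z = subtopology (power_topology n Z) {z. inj_on z {..<n}}"

text \<open>The copy of \<open>C\<^sup>n(Y)\<close> inside \<open>C\<^sup>n(Y \<times> I)\<close>.\<close>

definition base_config :: "nat \<Rightarrow> 'a topology \<Rightarrow> (nat \<Rightarrow> 'a \<times> real) set" where
  "base_config n Y = (\<lambda>y. \<lambda>i\<in>{..<n}. (y i, 0)) ` topspace (config_space n Y)"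

lemma base_config_subset:
  "base_config n Y \<subseteq> topspace (config_space n (prod_topology Y unit_interval))"
  by (auto simp: base_config_def config_space_def inj_on_def)

end

theory Submission
  imports Defs
begin

text \<open>A motion planner for \<open>Y\<^sup>n\<close> moves the \<open>n\<close> points of \<open>Y\<close> without regard to collisions. Over a
  configuration in \<open>Y \<times> {0}\<close>, first lift the points, with their \<open>Y\<close>-coordinates fixed and distinct,
  to pairwise distinct heights; then run the planner at these heights, where nothing can collide;
  finally lower all points to height \<open>0\<close> over the target configuration.\<close>

lemma continuous_map_compact_open_eval:
  assumes "neighbourhood_base_of (compactin X) X"
  shows "continuous_map (prod_topology (compact_open_topology X Y) X) Y (\<lambda>(f, x). f x)"
proof -
  let ?P = "prod_topology (compact_open_topology X Y) X"
  let ?ev = "\<lambda>(f, x). f x"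
  have cont: "continuous_map X Y f" if "f \<in> continuous_maps X Y" for f
    using that by (simp add: continuous_maps_def)
  have "openin ?P {z \<in> topspace ?P. ?ev z \<in> W}" if W: "openin Y W" for W
    unfolding openin_prod_topology_alt
  proof (intro allI impI)
    fix f x
    assume "(f, x) \<in> {z \<in> topspace ?P. ?ev z \<in> W}"
    then have f: "f \<in> continuous_maps X Y" and x: "x \<in> topspace X" "f x \<in> W"
      by (auto simp: topspace_compact_open_topology)
    have "openin X {u \<in> topspace X. f u \<in> W}"
      using cont[OF f] W by (rule openin_continuous_map_preimage)
    with assms x obtain U K where UK: "openin X U" "compactin X K" "x \<in> U" "U \<subseteq> K"
      "K \<subseteq> {u \<in> topspace X. f u \<in> W}"
      unfolding neighbourhood_base_of
      by (metis (mono_tags, lifting) mem_Collect_eq)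
    let ?G = "{g \<in> continuous_maps X Y. g ` K \<subseteq> W}"
    have "openin (compact_open_topology X Y) ?G"
      unfolding compact_open_topology_def
      by (rule topology_generated_by_Basis) (use UK W in blast)
    moreover have "f \<in> ?G"
      using f UK by blast
    moreover have "?G \<times> U \<subseteq> {z \<in> topspace ?P. ?ev z \<in> W}"
      using UK by (auto simp: topspace_compact_open_topology)
    ultimately show "\<exists>G U. openin (compact_open_topology X Y) G \<and> openin X U \<and> f \<in> G \<and> x \<in> U \<and>
        G \<times> U \<subseteq> {z \<in> topspace ?P. ?ev z \<in> W}"
      using UK by blast
  qed
  moreover have "?ev \<in> topspace ?P \<rightarrow> topspace Y"
    using cont by (auto simp: topspace_compact_open_topology dest: continuous_map_funspace)
  ultimately show ?thesis
    unfolding continuous_map_def by blast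
qed

text \<open>This turns a motion continuous in configuration and time jointly into a continuous map
  to the path space. By the tube lemma, if the open preimage of \<open>W\<close> contains
  \<open>{z} \<times> K\<close> with \<open>K\<close> compact, it contains
  \<open>S \<times> K\<close> for some open \<open>S\<close> around \<open>z\<close>. The
  restriction to \<open>topspace X\<close> makes the values extensional, as
  \<open>continuous_maps\<close> demands.\<close>

lemma continuous_map_compact_open_curry:
  assumes F: "continuous_map (prod_topology Z X) Y F"
  shows "continuous_map Z (compact_open_topology X Y) (\<lambda>z. \<lambda>x\<in>topspace X. F (z, x))"
    (is "continuous_map _ _ ?c")
proof -
  have c: "?c z \<in> continuous_maps X Y" if "z \<in> topspace Z" for z
  proof -
    have "continuous_map X Y (\<lambda>x. F (z, x))"
      using continuous_map_compose[OF _ F, of X "\<lambda>x. (z, x)"] that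
      by (simp add: o_def continuous_map_pairedI)
    then show ?thesis
      unfolding continuous_maps_def
      by (auto intro: continuous_map_eq)
  qed
  let ?B = "{{f \<in> continuous_maps X Y. f ` K \<subseteq> W} | K W. compactin X K \<and> openin Y W}"
  show ?thesis
    unfolding compact_open_topology_def
  proof (rule continuous_on_generated_topo)
    fix G assume "G \<in> ?B"
    then obtain K W where G: "G = {f \<in> continuous_maps X Y. f ` K \<subseteq> W}"
      and K: "compactin X K" and W: "openin Y W"
      by blast
    have KX: "K \<subseteq> topspace X"
      using K by (rule compactin_subset_topspace)
    let ?W = "{p \<in> topspace (prod_topology Z X). F p \<in> W}"
    have oW: "openin (prod_topology Z X) ?W"
      using F W by (rule openin_continuous_map_preimage)
    show "openin Z (?c -` G \<inter> topspace Z)"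
    proof (subst openin_subopen, intro ballI)
      fix z assume z: "z \<in> ?c -` G \<inter> topspace Z"
      have "F (z, x) \<in> W" if "x \<in> K" for x
      proof -
        have "?c z x \<in> W"
          using z that by (auto simp: G)
        then show ?thesis
          using KX that by auto
      qed
      with z KX have "{z} \<times> K \<subseteq> ?W"
        by auto
      moreover from z have "compactin Z {z}"
        by simp
      ultimately obtain S V where "openin Z S" "openin X V" "{z} \<subseteq> S" "K \<subseteq> V" "S \<times> V \<subseteq> ?W"
        using Wallace_theorem_prod_topology[OF _ K oW] by blast
      then have "openin Z S \<and> z \<in> S \<and> S \<subseteq> ?c -` G \<inter> topspace Z"
        using c KX openin_subset[of Z S] by (auto simp: G)
      then show "\<exists>T. openin Z T \<and> z \<in> T \<and> T \<subseteq> ?c -` G \<inter> topspace Z" ..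
    qed
  next
    \<comment> \<open>The union of the subbasis is \<open>continuous_maps X Y\<close>.\<close>
    show "?c ` topspace Z \<subseteq> \<Union> ?B"
      using c topspace_compact_open_topology[of X Y]
      unfolding compact_open_topology_def topology_generated_by_topspace by blast
  qed
qed

text \<open>Evaluation is continuous in path and time together because the interval is compact and
  regular, hence locally compact in the strong form.\<close>

lemma continuous_map_path_space_eval:
  "continuous_map (prod_topology (path_space X) unit_interval) X (\<lambda>(p, t). p t)"
  unfolding path_space_def
proof (rule continuous_map_compact_open_eval)
  have "compact_space unit_interval"
    by (simp add: compact_space_subtopology)
  moreover have "regular_space unit_interval"
    by (simp add: regular_space_subtopology regular_space_euclidean)
  ultimately show "neighbourhood_base_of (compactin unit_interval) unit_interval"
    using compact_imp_locally_compact_space locally_compact_space_neighbourhood_base by blast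
qed

text \<open>Defined on all configurations, so that its continuity can be stated on the whole
  configuration space; on \<open>base_config\<close> it inverts the embedding of C^n(Y).\<close>

definition base_coords :: "nat \<Rightarrow> (nat \<Rightarrow> 'a \<times> 'b) \<Rightarrow> nat \<Rightarrow> 'a" where
  "base_coords n a = (\<lambda>j\<in>{..<n}. fst (a j))"

lemma continuous_map_base_coords:
  "continuous_map (config_space n (prod_topology Y Z)) (power_topology n Y) (base_coords n)"
  unfolding base_coords_def config_space_def
  by (auto simp: continuous_map_componentwise
      intro!: continuous_map_from_subtopology continuous_map_fst_of[unfolded o_def]
        continuous_map_product_projection)

lemma base_configE:
  assumes "a \<in> base_config n Y"
  shows "a = (\<lambda>j\<in>{..<n}. (base_coords n a j, 0))" "inj_on (base_coords n a) {..<n}"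
    "base_coords n a \<in> topspace (power_topology n Y)"
proof -
  from assms obtain y where y: "y \<in> topspace (power_topology n Y)" "inj_on y {..<n}"
    and a: "a = (\<lambda>j\<in>{..<n}. (y j, 0))"
    by (auto simp: base_config_def config_space_def)
  have "base_coords n a = y"
    using y(1) by (auto simp: a base_coords_def fun_eq_iff PiE_def extensional_def)
  with y a show "a = (\<lambda>j\<in>{..<n}. (base_coords n a j, 0))" "inj_on (base_coords n a) {..<n}"
    "base_coords n a \<in> topspace (power_topology n Y)"
    by simp_all
qed

text \<open>The clock of the given planner: it waits at 0 in the first third, runs in the middle
  third and waits at 1 in the last.\<close>

definition stretched_time :: "real \<Rightarrow> real" where
  "stretched_time t = max 0 (min 1 (3 * t - 1))"

text \<open>A trapezoid: it is 1 on the middle third and positive exactly for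
  \<open>0 < t < 1\<close>.\<close>

definition plateau :: "real \<Rightarrow> real" where
  "plateau t = max 0 (min 1 (min (3 * t) (3 - 3 * t)))"

text \<open>The factors \<open>1 / Suc j\<close> are distinct numbers in (0,1], so the heights stay
  in the unit interval and differ whenever the plateau is nonzero.\<close>

definition lifted_motion :: "nat \<Rightarrow> (real \<Rightarrow> nat \<Rightarrow> 'a) \<Rightarrow> real \<Rightarrow> nat \<Rightarrow> 'a \<times> real" where
  "lifted_motion n p t = (\<lambda>j\<in>{..<n}. (p (stretched_time t) j, plateau t / real (Suc j)))"

text \<open>Nonzero plateau: the heights separate the points, even where \<open>p\<close> has
  collisions. Zero plateau: the clock stands at an end, where \<open>p\<close> itself is
  injective.\<close>

lemma inj_on_lifted_motion:
  assumes "inj_on (p 0) {..<n}" "inj_on (p 1) {..<n}"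
  shows "inj_on (lifted_motion n p t) {..<n}"
proof (cases "plateau t = 0")
  case True
  \<comment> \<open>A zero plateau means \<open>t \<le> 0\<close> or
    \<open>t \<ge> 1\<close>.\<close>
  then have "stretched_time t = 0 \<or> stretched_time t = 1"
    by (auto simp: stretched_time_def plateau_def max_def min_def split: if_splits)
  with assms show ?thesis
    by (auto simp: lifted_motion_def inj_on_def)
next
  case False
  then show ?thesis
    by (auto simp: lifted_motion_def inj_on_def)
qed

lemma continuous_map_lifted_motion:
  assumes s: "continuous_map T (path_space (power_topology n Y)) s"
    and inj: "\<And>z. z \<in> topspace T \<Longrightarrow> inj_on (s z 0) {..<n} \<and> inj_on (s z 1) {..<n}"
  shows "continuous_map (prod_topology T unit_interval)
    (config_space n (prod_topology Y unit_interval)) (\<lambda>(z, t). lifted_motion n (s z) t)"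
proof -
  let ?TI = "prod_topology T unit_interval"
  have cst: "continuous_map unit_interval unit_interval stretched_time"
    by (auto simp: stretched_time_def continuous_map_in_subtopology intro!: continuous_intros)
  have cpl: "continuous_map unit_interval unit_interval (\<lambda>t. plateau t / real (Suc j))" for j
  proof -
    have "0 \<le> plateau t / real (Suc j) \<and> plateau t / real (Suc j) \<le> 1" for t
      by (auto simp: plateau_def divide_simps)
    moreover have "continuous_on {0..1} (\<lambda>t. plateau t / real (Suc j))"
      unfolding plateau_def by (intro continuous_intros) auto
    ultimately show ?thesis
      by (auto simp: continuous_map_in_subtopology)
  qed
  \<comment> \<open>Running the planner at the stretched time is this map followed by evaluation on
    the path space.\<close>
  have "continuous_map ?TI (prod_topology (path_space (power_topology n Y)) unit_interval)
      (\<lambda>q. (s (fst q), stretched_time (snd q)))"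
    using continuous_map_compose[OF continuous_map_fst s]
      continuous_map_compose[OF continuous_map_snd cst]
    by (auto simp: o_def intro!: continuous_map_pairedI)
  from continuous_map_compose[OF this continuous_map_path_space_eval]
  have cp: "continuous_map ?TI (power_topology n Y) (\<lambda>q. s (fst q) (stretched_time (snd q)))"
    by (simp add: o_def)
  have "continuous_map ?TI (prod_topology Y unit_interval)
      (\<lambda>q. (s (fst q) (stretched_time (snd q)) j, plateau (snd q) / real (Suc j)))"
    if j: "j < n" for j
  proof (rule continuous_map_pairedI)
    show "continuous_map ?TI Y (\<lambda>q. s (fst q) (stretched_time (snd q)) j)"
      using cp j by (simp add: continuous_map_componentwise)
    show "continuous_map ?TI unit_interval (\<lambda>q. plateau (snd q) / real (Suc j))"
      using continuous_map_compose[OF continuous_map_snd cpl[of j]] by (simp add: o_def)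
  qed
  then have "continuous_map ?TI (power_topology n (prod_topology Y unit_interval))
      (\<lambda>q. lifted_motion n (s (fst q)) (snd q))"
    by (auto simp: lifted_motion_def continuous_map_componentwise)
  then show ?thesis
    unfolding config_space_def case_prod_beta
    using inj by (auto simp: continuous_map_in_subtopology inj_on_lifted_motion)
qed

theorem theorem3p2:
  fixes n :: nat and Y :: "'a topology"
  assumes "n \<ge> 1"
    and "\<exists>S \<subseteq> topspace Y. finite S \<and> card S = n"
  shows "TC_on (config_space n (prod_topology Y unit_interval))
           (base_config n Y \<times> base_config n Y)
         \<le> TC (power_topology n Y)"
proof -
  let ?X = "config_space n (prod_topology Y unit_interval)"
  let ?XX = "prod_topology ?X ?X"
  let ?P = "power_topology n Y"
  let ?A = "base_config n Y \<times> base_config n Y"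
  define q where "q = (\<lambda>(a :: nat \<Rightarrow> 'a \<times> real, b :: nat \<Rightarrow> 'a \<times> real). (base_coords n a, base_coords n b))"
  have q: "continuous_map ?XX (prod_topology ?P ?P) q"
    unfolding q_def case_prod_beta
    by (intro continuous_map_pairedI continuous_map_compose[OF continuous_map_fst
          continuous_map_base_coords, unfolded o_def] continuous_map_compose[OF continuous_map_snd
          continuous_map_base_coords, unfolded o_def])
  have AX: "?A \<subseteq> topspace ?XX"
    using base_config_subset[of n Y] by auto
  show ?thesis
    unfolding TC_def TC_on_def
  \<comment> \<open>Each number of sets that works for Y^n also works for \<open>?A\<close>;
    comparing the two sets of numbers covers the infinite case too.\<close>
  proof (rule Inf_superset_mono, clarify)
    fix k :: nat
    fix U :: "nat \<Rightarrow> ((nat \<Rightarrow> 'a) \<times> (nat \<Rightarrow> 'a)) set" and s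
    assume cover: "(\<Union>i<k. U i) = topspace (prod_topology ?P ?P)"
      and "\<forall>i<k. openin (prod_topology ?P ?P) (U i) \<and>
        continuous_map (subtopology (prod_topology ?P ?P) (U i)) (path_space ?P) (s i) \<and>
        (\<forall>(x, y) \<in> U i. s i (x, y) 0 = x \<and> s i (x, y) 1 = y)"
    then have U: "openin (prod_topology ?P ?P) (U i)"
      and s: "continuous_map (subtopology (prod_topology ?P ?P) (U i)) (path_space ?P) (s i)"
      and ends: "\<And>x y. (x, y) \<in> U i \<Longrightarrow> s i (x, y) 0 = x \<and> s i (x, y) 1 = y"
      if "i < k" for i
      using that by auto
    \<comment> \<open>The cover and the planner are pulled back along \<open>q\<close>, which
      forgets the heights.\<close>
    define V where "V i = {z \<in> ?A. q z \<in> U i}" for i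
    define r where "r i z = (\<lambda>t\<in>{0..1}. lifted_motion n (s i (q z)) t)" for i z
    have "(\<Union>i<k. V i) = ?A"
    proof -
      have "q z \<in> (\<Union>i<k. U i)" if "z \<in> ?A" for z
        unfolding cover using that base_configE(3) by (auto simp: q_def)
      then show ?thesis
        by (auto simp: V_def)
    qed
    moreover have "openin (subtopology ?XX ?A) (V i)" if "i < k" for i
    proof -
      \<comment> \<open>Since \<open>q\<close> is continuous on all of \<open>?XX\<close>,
        \<open>V i\<close> is the trace on \<open>?A\<close> of an open set.\<close>
      have "V i = {z \<in> topspace ?XX. q z \<in> U i} \<inter> ?A"
        using AX by (auto simp: V_def)
      then show ?thesis
        using openin_continuous_map_preimage[OF q U[OF that]] openin_subtopology by blast
    qed
    \<comment> \<open>At times 0 and 1 the plateau vanishes and the clock shows 0 and 1, so the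
      motion starts and ends at height 0 over the prescribed configurations.\<close>
    moreover have r_ends: "r i (a, b) 0 = a \<and> r i (a, b) 1 = b" if "i < k" "(a, b) \<in> V i" for i a b
    proof -
      have a: "a = (\<lambda>j\<in>{..<n}. (base_coords n a j, 0))"
        and b: "b = (\<lambda>j\<in>{..<n}. (base_coords n b j, 0))"
        using that base_configE(1) by (auto simp: V_def)
      have "s i (q (a, b)) 0 = base_coords n a" "s i (q (a, b)) 1 = base_coords n b"
        using that ends[OF that(1)] by (auto simp: V_def q_def)
      then show ?thesis
        using a b by (simp add: r_def lifted_motion_def stretched_time_def plateau_def)
    qed
    moreover have "continuous_map (subtopology ?XX (V i)) (path_space_on ?X ?A) (r i)"
      if i: "i < k" for i
    proof -
      let ?T = "subtopology ?XX (V i)"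
      have "continuous_map ?T (subtopology (prod_topology ?P ?P) (U i)) q"
        using q by (auto simp: continuous_map_in_subtopology V_def
            intro: continuous_map_from_subtopology)
      then have "continuous_map ?T (path_space ?P) (\<lambda>z. s i (q z))"
        using continuous_map_compose[OF _ s[OF i]] by (simp add: o_def)
      \<comment> \<open>The planner's paths begin and end at coordinates of base configurations,
        which are pairwise distinct.\<close>
      moreover have "inj_on (s i (q z) 0) {..<n} \<and> inj_on (s i (q z) 1) {..<n}"
        if "z \<in> topspace ?T" for z
        using that ends[OF i] base_configE(2) by (auto simp: V_def q_def)
      ultimately have "continuous_map (prod_topology ?T unit_interval) ?X
          (\<lambda>(z, t). lifted_motion n (s i (q z)) t)"
        by (rule continuous_map_lifted_motion)
      then have "continuous_map ?T (path_space ?X) (r i)"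
        using continuous_map_compact_open_curry unfolding r_def path_space_def by fastforce
      \<comment> \<open>Only the ends of a path must lie in the base; this places the paths in
        \<open>path_space_on ?X ?A\<close>.\<close>
      moreover have "(r i z 0, r i z 1) \<in> ?A" if "z \<in> V i" for z
        using that r_ends[OF i, of "fst z" "snd z"] by (auto simp: V_def)
      ultimately show ?thesis
        by (auto simp: path_space_on_def continuous_map_in_subtopology)
    qed
    ultimately show "\<exists>k'. enat k = enat k' \<and> (\<exists>U s. (\<Union>i<k'. U i) = ?A \<and>
        (\<forall>i<k'. openin (subtopology ?XX ?A) (U i) \<and>
          continuous_map (subtopology ?XX (U i)) (path_space_on ?X ?A) (s i) \<and>
          (\<forall>(x, y) \<in> U i. s i (x, y) 0 = x \<and> s i (x, y) 1 = y)))"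
      by (intro exI[of _ k] conjI refl exI[of _ V] exI[of _ r]) auto
  qed
qed

end
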